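(* Let $\mathcal{A}$ be a lazy paging algorithm. If $\mathcal{A}$ is stable, then $\mathcal{A}$ is a stack algorithm.
   Context: $\mathcal{A}_k$ is paging algorithm $\mathcal{A}$ on an initially empty cache of size $k$; $\mathcal{A}_k(\sigma)$ is the set of cached items after serving $\sigma\in\mathcal{U}^*$; $\textsf{Out}(\mathcal{A}_k,\tau,z):=\mathcal{A}_k(\tau)\setminus\mathcal{A}_k(\tau z)$; $\tau[X]$ is the subsequence of $\tau$ of requests to items in $X\subseteq\mathcal{U}$. Lazy: fetches only on a miss, evicts at most one item per miss, and only when full. Stable: for every $\tau\in\mathcal{U}^*$, $X\subseteq\mathcal{U}$, $z\in X$, integers $a>b\ge1$, $\textsf{Out}(\mathcal{A}_b,\tau[X],z)\cap\mathcal{A}_a(\tau z)\neq\emptyset$ implies $\mathcal{A}_b(\tau[X]z)\subseteq\mathcal{A}_a(\tau z)$. Stack algorithm: $\mathcal{A}_k(\sigma)\subseteq\mathcal{A}_{k+1}(\sigma)$ for every $\sigma$ and $k$. *)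

theory Defs
  imports Main
begin

text \<open>
  The type \<open>'a\<close> is the universe of items. A (deterministic, online) algorithm is given by the
  map sending a cache size \<open>k\<close> and a request sequence \<open>\<sigma>\<close> to the cache contents
  after serving \<open>\<sigma>\<close> from an empty cache. The contents may depend on the whole history, so
  arbitrary internal state is allowed. Only cache sizes \<open>k \<ge> 1\<close> are meaningful;
  nothing is assumed about \<open>A 0\<close>.
\<close>

type_synonym 'a paging = "nat \<Rightarrow> 'a list \<Rightarrow> 'a set"

definition paging_algorithm :: "'a paging \<Rightarrow> bool" where
  "paging_algorithm A \<longleftrightarrow>
     (\<forall>k\<ge>1. A k [] = {} \<and>
        (\<forall>\<sigma>. finite (A k \<sigma>) \<and> card (A k \<sigma>) \<le> k) \<and>
        (\<forall>\<sigma> z. z \<in> A k (\<sigma> @ [z])))"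

definition Out :: "('a list \<Rightarrow> 'a set) \<Rightarrow> 'a list \<Rightarrow> 'a \<Rightarrow> 'a set" where
  "Out Ak \<tau> z = Ak \<tau> - Ak (\<tau> @ [z])"

definition Fetched :: "('a list \<Rightarrow> 'a set) \<Rightarrow> 'a list \<Rightarrow> 'a \<Rightarrow> 'a set" where
  "Fetched Ak \<tau> z = Ak (\<tau> @ [z]) - Ak \<tau>"

definition restrict_seq :: "'a list \<Rightarrow> 'a set \<Rightarrow> 'a list" where
  "restrict_seq \<tau> X = filter (\<lambda>x. x \<in> X) \<tau>"

text \<open>
  An item is fetched only on a miss to that item (no prefetching); evictions happen only on
  misses, at most one per miss, and only if the cache is full when the request arrives.
\<close>

definition lazy_paging :: "'a paging \<Rightarrow> bool" where
  "lazy_paging A \<longleftrightarrow>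
     (\<forall>k\<ge>1. \<forall>\<tau> z.
        (\<forall>x \<in> Fetched (A k) \<tau> z. x = z \<and> z \<notin> A k \<tau>) \<and>
        (Out (A k) \<tau> z \<noteq> {} \<longrightarrow> z \<notin> A k \<tau> \<and> card (A k \<tau>) = k) \<and>
        card (Out (A k) \<tau> z) \<le> 1)"

definition stable_paging :: "'a paging \<Rightarrow> bool" where
  "stable_paging A \<longleftrightarrow>
     (\<forall>\<tau> X. \<forall>z\<in>X. \<forall>a b. a > b \<and> b \<ge> 1 \<longrightarrow>
        Out (A b) (restrict_seq \<tau> X) z \<inter> A a (\<tau> @ [z]) \<noteq> {} \<longrightarrow>
        A b (restrict_seq \<tau> X @ [z]) \<subseteq> A a (\<tau> @ [z]))"

definition stack_algorithm :: "'a paging \<Rightarrow> bool" where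
  "stack_algorithm A \<longleftrightarrow> (\<forall>k\<ge>1. \<forall>\<sigma>. A k \<sigma> \<subseteq> A (k + 1) \<sigma>)"

end

theory Submission
  imports Defs
begin

text \<open>
  Induct on the request sequence and use stability only with \<open>X = UNIV\<close>. Suppose that serving \<open>z\<close>
  makes the larger cache drop an item \<open>x\<close> which the smaller one keeps. The larger cache was then full,
  so the smaller one was full too (a cache that is not full still holds every item requested so far)
  and had to evict some \<open>y \<noteq> x\<close>. As the larger cache evicts only \<open>x\<close>, it keeps \<open>y\<close>, and stability
  forces the new small cache into the new large one, contradicting the choice of \<open>x\<close>.
\<close>

lemma lazy_paging_subset_set:
  assumes "paging_algorithm A" "lazy_paging A" "k \<ge> 1"
  shows "A k \<sigma> \<subseteq> set \<sigma>"
proof (induction \<sigma> rule: rev_induct)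
  case Nil
  then show ?case using assms(1,3) by (simp add: paging_algorithm_def)
next
  case (snoc z \<sigma>)
  have "A k (\<sigma> @ [z]) \<subseteq> insert z (A k \<sigma>)"
    using assms(2,3) unfolding lazy_paging_def Fetched_def by blast
  then show ?case using snoc by auto
qed

text \<open>The old contents survive and the requested item is new, so the inclusion is strict.
  Combined with the capacity bound, this shows that the cache had room before the request.\<close>

lemma paging_miss_no_eviction:
  assumes "paging_algorithm A" "k \<ge> 1" "Out (A k) \<sigma> z = {}" "z \<notin> A k \<sigma>"
  shows "card (A k \<sigma>) < card (A k (\<sigma> @ [z]))"
proof -
  have "A k \<sigma> \<subset> A k (\<sigma> @ [z])" "finite (A k (\<sigma> @ [z]))"
    using assms by (auto simp: paging_algorithm_def Out_def)
  then show ?thesis by (rule psubset_card_mono[rotated])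
qed

text \<open>A full cache loses at most one item and the missed item refills the slot; capacity gives
  the other bound.\<close>

lemma lazy_paging_eviction_stays_full:
  assumes "paging_algorithm A" "lazy_paging A" "k \<ge> 1" "Out (A k) \<sigma> z \<noteq> {}"
  shows "card (A k (\<sigma> @ [z])) = k"
proof -
  have full: "card (A k \<sigma>) = k" and miss: "z \<notin> A k \<sigma>" and one: "card (Out (A k) \<sigma> z) \<le> 1"
    using assms(2-4) unfolding lazy_paging_def by blast+
  have fin: "finite (A k \<sigma>)" "finite (A k (\<sigma> @ [z]))" and z: "z \<in> A k (\<sigma> @ [z])"
    using assms(1,3) by (auto simp: paging_algorithm_def)
  have "card (A k \<sigma> - Out (A k) \<sigma> z) \<ge> k - 1"
    using diff_card_le_card_Diff[of "Out (A k) \<sigma> z" "A k \<sigma>"] fin full one by (simp add: Out_def)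
  moreover have "insert z (A k \<sigma> - Out (A k) \<sigma> z) \<subseteq> A k (\<sigma> @ [z])"
    using z by (auto simp: Out_def)
  then have "card (insert z (A k \<sigma> - Out (A k) \<sigma> z)) \<le> card (A k (\<sigma> @ [z]))"
    using fin by (intro card_mono)
  \<comment> \<open>By \<open>miss\<close>, inserting \<open>z\<close> adds one to the at least
    \<open>k - 1\<close> survivors.\<close>
  ultimately have "k \<le> card (A k (\<sigma> @ [z]))"
    using fin miss by simp
  moreover have "card (A k (\<sigma> @ [z])) \<le> k"
    using assms(1,3) by (simp add: paging_algorithm_def)
  ultimately show ?thesis by simp
qed

text \<open>A cache with room after a request evicted nothing at that request and had room before
  it, so going back to the empty sequence no item was ever lost.\<close>

lemma lazy_paging_not_full_contains_set:
  assumes "paging_algorithm A" "lazy_paging A" "k \<ge> 1" "card (A k \<sigma>) < k"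
  shows "set \<sigma> \<subseteq> A k \<sigma>"
  using assms(4)
proof (induction \<sigma> rule: rev_induct)
  case Nil
  then show ?case by simp
next
  case (snoc z \<sigma>)
  have no_out: "Out (A k) \<sigma> z = {}"
    using lazy_paging_eviction_stays_full[OF assms(1-3)] snoc.prems by force
  have mono: "A k \<sigma> \<subseteq> A k (\<sigma> @ [z])"
    using no_out by (auto simp: Out_def)
  moreover have "finite (A k (\<sigma> @ [z]))" and z: "z \<in> A k (\<sigma> @ [z])"
    using assms(1,3) by (auto simp: paging_algorithm_def)
  ultimately have "card (A k \<sigma>) \<le> card (A k (\<sigma> @ [z]))"
    by (intro card_mono)
  then show ?case using snoc mono z by auto
qed

theorem theorem18:
  fixes A :: "'a paging"
  assumes "paging_algorithm A"
    and "lazy_paging A"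
    and "stable_paging A"
  shows "stack_algorithm A"
  unfolding stack_algorithm_def
proof (intro allI impI)
  fix k :: nat and \<sigma> :: "'a list"
  assume k: "k \<ge> 1"
  show "A k \<sigma> \<subseteq> A (k + 1) \<sigma>"
  proof (induction \<sigma> rule: rev_induct)
    case Nil
    then show ?case using assms(1) k by (simp add: paging_algorithm_def)
  next
    case (snoc z \<sigma>)
    show ?case
    proof (rule ccontr)
      assume not_sub: "\<not> A k (\<sigma> @ [z]) \<subseteq> A (k + 1) (\<sigma> @ [z])"
      then obtain x where x: "x \<in> A k (\<sigma> @ [z])" "x \<notin> A (k + 1) (\<sigma> @ [z])"
        by blast
      have "z \<in> A (k + 1) (\<sigma> @ [z])"
        using assms(1) by (simp add: paging_algorithm_def)
      then have "x \<noteq> z" using x by auto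
      then have "x \<in> A k \<sigma>"
        using assms(2) k x(1) unfolding lazy_paging_def Fetched_def by blast
      then have x_out: "x \<in> Out (A (k + 1)) \<sigma> z"
        using snoc x(2) by (auto simp: Out_def)
      have "1 \<le> k + 1" by simp
      then have miss: "z \<notin> A (k + 1) \<sigma>" and full: "card (A (k + 1) \<sigma>) = k + 1"
        and one: "card (Out (A (k + 1)) \<sigma> z) \<le> 1"
        using assms(2) x_out unfolding lazy_paging_def by blast+
      have fin: "finite (A k \<sigma>)" "finite (A (k + 1) \<sigma>)" and cap: "card (A k (\<sigma> @ [z])) \<le> k"
        using assms(1) k by (auto simp: paging_algorithm_def)
      \<comment> \<open>Otherwise the smaller cache had room and held every item requested so far,
        yet the larger one holds \<open>k + 1\<close> such items.\<close>
      have "Out (A k) \<sigma> z \<noteq> {}"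
      proof
        assume "Out (A k) \<sigma> z = {}"
        moreover have "z \<notin> A k \<sigma>" using miss snoc by blast
        ultimately have less: "card (A k \<sigma>) < k"
          using paging_miss_no_eviction[OF assms(1) k] cap by fastforce
        then have "set \<sigma> \<subseteq> A k \<sigma>"
          using lazy_paging_not_full_contains_set[OF assms(1,2) k] by blast
        moreover have "A (k + 1) \<sigma> \<subseteq> set \<sigma>"
          using lazy_paging_subset_set[OF assms(1,2)] by simp
        ultimately have "card (A (k + 1) \<sigma>) \<le> card (A k \<sigma>)"
          using fin by (intro card_mono) auto
        then show False using less full by simp
      qed
      then obtain y where y: "y \<in> Out (A k) \<sigma> z" by blast
      then have "x \<noteq> y" using x(1) by (auto simp: Out_def)
      \<comment> \<open>\<open>card\<close> is 0 on infinite sets, so \<open>one\<close> bounds the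
        number of evicted items only once finiteness is known.\<close>
      have "finite (Out (A (k + 1)) \<sigma> z)" using fin by (simp add: Out_def)
      then have "y \<notin> Out (A (k + 1)) \<sigma> z"
        using one x_out \<open>x \<noteq> y\<close> by (auto simp: card_le_Suc0_iff_eq)
      then have "y \<in> Out (A k) \<sigma> z \<inter> A (k + 1) (\<sigma> @ [z])"
        using y snoc by (auto simp: Out_def)
      \<comment> \<open>Restricting to \<open>UNIV\<close> leaves \<sigma> unchanged, so stability
        with sizes \<open>k + 1\<close> and \<open>k\<close> compares both caches on the same
        sequence.\<close>
      moreover have "Out (A k) (restrict_seq \<sigma> UNIV) z \<inter> A (k + 1) (\<sigma> @ [z]) \<noteq> {} \<longrightarrow>
          A k (restrict_seq \<sigma> UNIV @ [z]) \<subseteq> A (k + 1) (\<sigma> @ [z])"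
        using assms(3) k unfolding stable_paging_def
        by (metis UNIV_I less_add_one)
      ultimately show False
        using not_sub by (auto simp: restrict_seq_def)
    qed
  qed
qed

end
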